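(* Let $a>b>0$, $c=\sqrt{a^2-b^2}$, and let $\mathcal{E}$ be the ellipse $(x/a)^2+(y/b)^2=1$. Over the focal-$X_1$ family, i.e., the Poncelet family of triangles inscribed in $\mathcal{E}$ whose common incircle is the circle with center $[c,0]$ and radius $r_1=\frac{b^2}{c^2}\left(\sqrt{a^2+c^2}-a\right)$, the sum of half-angle sines is invariant and given by $$\sum_{i=1}^{3}\sin\frac{\theta_i}{2}=\frac{c^2-a^2+a\sqrt{a^2+c^2}}{c^2},$$ where $\theta_1,\theta_2,\theta_3$ are the internal angles of a triangle of the family.
   Context: Points of the plane are written $[x,y]$. The Poncelet family of triangles inscribed in $\mathcal{E}$ with a given circle as incircle (caustic) is the set of all triangles with vertices on $\mathcal{E}$ whose three sides are tangent to the circle; for the circle given, every point of $\mathcal{E}$ is a vertex of such a triangle. *)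

theory Defs
  imports "HOL-Analysis.Analysis"
begin

definition ellipse :: "real \<Rightarrow> real \<Rightarrow> (real^2) set" where
  "ellipse a b = {p. (p$1 / a)\<^sup>2 + (p$2 / b)\<^sup>2 = 1}"

text \<open>The side \<open>PQ\<close> is the segment, so the point of contact must lie on it. This is what
  makes a circle tangent to all three sides of a triangle its incircle, not an excircle.\<close>

definition side_tangent_to_circle :: "real^2 \<Rightarrow> real^2 \<Rightarrow> real^2 \<Rightarrow> real \<Rightarrow> bool" where
  "side_tangent_to_circle P Q z r \<longleftrightarrow>
     (\<exists>T \<in> closed_segment P Q. affine hull {P, Q} \<inter> sphere z r = {T})"

definition poncelet_family ::
    "(real^2) set \<Rightarrow> real^2 \<Rightarrow> real \<Rightarrow> ((real^2) \<times> (real^2) \<times> (real^2)) set" where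
  "poncelet_family E z r =
     {(P, Q, R). \<not> collinear {P, Q, R} \<and> P \<in> E \<and> Q \<in> E \<and> R \<in> E \<and>
        side_tangent_to_circle P Q z r \<and>
        side_tangent_to_circle Q R z r \<and>
        side_tangent_to_circle R P z r}"

text \<open>\<open>internal_angle P Q R\<close> is the angle at the middle argument \<open>Q\<close>.\<close>

definition internal_angle :: "real^2 \<Rightarrow> real^2 \<Rightarrow> real^2 \<Rightarrow> real" where
  "internal_angle P Q R = arccos (((P - Q) \<bullet> (R - Q)) / (norm (P - Q) * norm (R - Q)))"

end

theory Submission
  imports Defs
begin

text \<open>
  Let \<open>F = [c, 0]\<close> be the common incenter, a focus of the ellipse, and let \<open>u\<close>, \<open>v\<close>, \<open>w\<close> be the
  unit vectors from \<open>F\<close> to the vertices \<open>P\<close>, \<open>Q\<close>, \<open>R\<close>. The sine of half the angle at \<open>P\<close> is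
  \<open>r / dist P F\<close>, and since the angle \<open>QFR\<close> exceeds a right angle by half the angle at \<open>P\<close>, it is
  also \<open>- (v \<bullet> w)\<close> (\<open>half_angle_and_opposite_directions\<close>).

  The polar equation of the ellipse about its focus makes \<open>r / dist P F\<close> an affine function of the
  direction: it equals \<open>r * a / b\<^sup>2 + h \<bullet> u\<close> with \<open>h = [r * c / b\<^sup>2, 0]\<close>
  (\<open>ellipse_focal_polar\<close>). Comparing the two expressions for two vertices at a time gives
  \<open>(w - h) \<bullet> (u - v) = 0\<close> and its cyclic variants. So the fixed point \<open>h\<close> is the orthocenter of the
  triangle \<open>u v w\<close>, which is inscribed in the unit circle, and therefore \<open>h = u + v + w\<close>
  (\<open>orthocenter_eq_sum\<close>). Taking norms, \<open>h \<bullet> h\<close> is \<open>3\<close> minus twice the sum of the half-angle sines.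
  The sum is thus \<open>(3 - (r * c / b\<^sup>2)\<^sup>2) / 2\<close>, the same for every triangle
  (\<open>sum_sin_half_angles_focal\<close>).

  The facts about a triangle and its incircle are derived from the tangent lengths \<open>x\<close>, \<open>y\<close>, \<open>w\<close> of
  the three vertices. They determine all inner products of the vectors from the incenter to the
  vertices, and the vanishing of the Gram determinant of these three plane vectors is Heron's
  relation \<open>x * y * w = r\<^sup>2 * (x + y + w)\<close> (\<open>tangent_lengths_product\<close>). That relation takes the
  place of the angle sum of the triangle.
\<close>

section \<open>Tangents from a vertex to the incircle\<close>

text \<open>If the radius were not orthogonal to the line, the reflection of the point of contact in the
  foot of the perpendicular from the center would be a second common point.\<close>

lemma line_tangent_orthogonal:
  fixes P Q T z :: "'a::euclidean_space"
  assumes "affine hull {P, Q} \<inter> sphere z r = {T}"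
  shows "(T - z) \<bullet> (Q - P) = 0"
proof (cases "P = Q")
  case False
  define v where "v = Q - P"
  \<comment> \<open>\<open>T - k *\<^sub>R v\<close> is the reflected point.\<close>
  define k where "k = 2 * ((T - z) \<bullet> v) / (v \<bullet> v)"
  have v: "v \<bullet> v \<noteq> 0"
    using False by (simp add: v_def)
  have T: "T \<in> affine hull {P, Q}" "norm (T - z) = r"
    using assms by (auto simp: dist_norm norm_minus_commute)
  from T(1) obtain t where t: "T = P + t *\<^sub>R v"
    by (auto simp: affine_hull_2_alt v_def)
  have "T - k *\<^sub>R v = P + (t - k) *\<^sub>R v"
    by (simp add: t algebra_simps)
  then have line: "T - k *\<^sub>R v \<in> affine hull {P, Q}"
    by (auto simp: affine_hull_2_alt v_def)
  have "(norm (T - k *\<^sub>R v - z))\<^sup>2 = (norm (T - z))\<^sup>2 - 2 * k * ((T - z) \<bullet> v) + k\<^sup>2 * (v \<bullet> v)"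
    unfolding power2_norm_eq_inner
    by (simp add: inner_diff_left inner_diff_right inner_commute algebra_simps power2_eq_square)
  also have "\<dots> = (norm (T - z))\<^sup>2"
    using v by (simp add: k_def field_simps power2_eq_square)
  finally have "norm (T - k *\<^sub>R v - z) = r"
    using T(2) by (simp add: norm_eq_sqrt_inner)
  then have "T - k *\<^sub>R v \<in> sphere z r"
    by (simp add: dist_norm norm_minus_commute)
  with line assms have "T - k *\<^sub>R v = T"
    by blast
  then have "k = 0"
    using v by auto
  then show ?thesis
    using v by (simp add: k_def v_def)
qed simp

definition tangent_length :: "'a::real_normed_vector \<Rightarrow> real \<Rightarrow> 'a \<Rightarrow> real" where
  "tangent_length z r P = sqrt ((dist P z)\<^sup>2 - r\<^sup>2)"

text \<open>Split both \<open>P - z\<close> and \<open>Q - z\<close> into the radius to the point of contact and a part along the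
  side. The point of contact lies between \<open>P\<close> and \<open>Q\<close>, so the parts along the side have opposite
  directions: this is where the circle is seen to be the incircle and not an excircle. It gives the
  minus sign in the inner product and the plus sign in the length of the side.\<close>

lemma tangent_side_metric:
  assumes "side_tangent_to_circle P Q z r"
  defines "x \<equiv> tangent_length z r P" and "y \<equiv> tangent_length z r Q"
  shows "0 \<le> x" and "0 \<le> y"
    and "(P - z) \<bullet> (P - z) = r\<^sup>2 + x\<^sup>2"
    and "(Q - z) \<bullet> (Q - z) = r\<^sup>2 + y\<^sup>2"
    and "(P - z) \<bullet> (Q - z) = r\<^sup>2 - x * y"
    and "dist P Q = x + y"
proof -
  from assms(1) obtain T where T: "T \<in> closed_segment P Q"
    and hull: "affine hull {P, Q} \<inter> sphere z r = {T}"
    unfolding side_tangent_to_circle_def by blast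
  define v where "v = Q - P"
  define n where "n = T - z"
  have orth: "n \<bullet> v = 0" "v \<bullet> n = 0"
    using line_tangent_orthogonal[OF hull] by (simp_all add: v_def n_def inner_commute)
  have "norm n = r"
    using hull by (auto simp: n_def dist_norm norm_minus_commute)
  then have n: "n \<bullet> n = r\<^sup>2"
    by (simp flip: power2_norm_eq_inner)
  from T obtain t where t: "0 \<le> t" "t \<le> 1" "T = (1 - t) *\<^sub>R P + t *\<^sub>R Q"
    by (auto simp: in_segment)
  have P: "P - z = n - t *\<^sub>R v" and Q: "Q - z = n + (1 - t) *\<^sub>R v"
    by (simp_all add: n_def v_def t(3) algebra_simps)
  have PP: "(P - z) \<bullet> (P - z) = r\<^sup>2 + (t * norm v)\<^sup>2"
    unfolding P using n orth
    by (simp add: inner_diff_left inner_diff_right power_mult_distrib power2_norm_eq_inner)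
      (simp add: power2_eq_square)
  have QQ: "(Q - z) \<bullet> (Q - z) = r\<^sup>2 + ((1 - t) * norm v)\<^sup>2"
    unfolding Q using n orth
    by (simp add: inner_add_left inner_add_right power_mult_distrib power2_norm_eq_inner)
      (simp add: power2_eq_square)
  have "x = t * norm v" "y = (1 - t) * norm v"
    using PP QQ t unfolding x_def y_def tangent_length_def dist_norm power2_norm_eq_inner
    by (simp_all del: inner_eq_zero_iff)
  note xy = this
  show "0 \<le> x" "0 \<le> y"
    using t by (simp_all add: xy)
  show "(P - z) \<bullet> (P - z) = r\<^sup>2 + x\<^sup>2" "(Q - z) \<bullet> (Q - z) = r\<^sup>2 + y\<^sup>2"
    using PP QQ by (simp_all add: xy)
  have "(P - z) \<bullet> (Q - z) = r\<^sup>2 - t * (1 - t) * (v \<bullet> v)"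
    unfolding P Q using n orth
    by (simp add: inner_add_left inner_add_right inner_diff_left inner_diff_right algebra_simps)
  then show "(P - z) \<bullet> (Q - z) = r\<^sup>2 - x * y"
    by (simp add: xy dot_square_norm power2_eq_square)
  show "dist P Q = x + y"
    by (simp add: xy v_def dist_norm norm_minus_commute algebra_simps)
qed

section \<open>Half-angles of a triangle seen from its incenter\<close>

text \<open>The Gram determinant of three vectors of the plane vanishes because they are linearly
  dependent.\<close>

lemma gram_det_3_real2:
  fixes p q w :: "real^2"
  shows "(p \<bullet> p) * (q \<bullet> q) * (w \<bullet> w) + 2 * (p \<bullet> q) * (q \<bullet> w) * (w \<bullet> p)
    = (p \<bullet> p) * (q \<bullet> w)\<^sup>2 + (q \<bullet> q) * (w \<bullet> p)\<^sup>2 + (w \<bullet> w) * (p \<bullet> q)\<^sup>2"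
  by (simp add: inner_vec_def sum_2 algebra_simps power2_eq_square)

text \<open>A vertex on the circle would lie on the opposite side, by the triangle equality for the side
  lengths.\<close>

lemma tangent_length_pos:
  fixes P Q R z :: "real^2"
  assumes "\<not> collinear {P, Q, R}"
    and "side_tangent_to_circle P Q z r" "side_tangent_to_circle Q R z r"
      "side_tangent_to_circle R P z r"
  shows "0 < tangent_length z r P"
proof (rule ccontr)
  assume "\<not> 0 < tangent_length z r P"
  with tangent_side_metric(1)[OF assms(2)] have "tangent_length z r P = 0"
    by linarith
  then have "dist Q R = dist Q P + dist P R"
    using tangent_side_metric(6)[OF assms(2)] tangent_side_metric(6)[OF assms(3)]
      tangent_side_metric(6)[OF assms(4)] by (simp add: dist_commute)
  then have "between (Q, R) P"
    by (simp add: between)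
  then have "collinear {Q, P, R}"
    using between_imp_collinear collinear_between_cases by blast
  with assms(1) show False
    by (simp add: insert_commute)
qed

text \<open>With \<open>s = x + y + w\<close> the semiperimeter, the area is \<open>r * s\<close>, and Heron's formula for its square
  reads \<open>s * x * y * w = r\<^sup>2 * s\<^sup>2\<close>. Here the relation comes out as the nontrivial factor of
  the Gram determinant of the vectors from the center to the vertices.\<close>

lemma tangent_lengths_product:
  fixes P Q R z :: "real^2"
  assumes "\<not> collinear {P, Q, R}"
    and "side_tangent_to_circle P Q z r" "side_tangent_to_circle Q R z r"
      "side_tangent_to_circle R P z r"
  defines "x \<equiv> tangent_length z r P" and "y \<equiv> tangent_length z r Q"
    and "w \<equiv> tangent_length z r R"
  shows "x * y * w = r\<^sup>2 * (x + y + w)"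
proof -
  note m = tangent_side_metric[OF assms(2)] tangent_side_metric[OF assms(3)]
    tangent_side_metric[OF assms(4)]
  \<comment> \<open>The entries of the Gram matrix.\<close>
  define A B C where "A = r\<^sup>2 + x\<^sup>2" and "B = r\<^sup>2 + y\<^sup>2" and "C = r\<^sup>2 + w\<^sup>2"
  define D E F where "D = r\<^sup>2 - x * y" and "E = r\<^sup>2 - y * w" and "F = r\<^sup>2 - w * x"
  have "A * B * C + 2 * D * E * F = A * E\<^sup>2 + B * F\<^sup>2 + C * D\<^sup>2"
    using gram_det_3_real2[of "P - z" "Q - z" "R - z"] m
    by (simp only: A_def B_def C_def D_def E_def F_def x_def y_def w_def)
  moreover have "A * B * C + 2 * D * E * F - (A * E\<^sup>2 + B * F\<^sup>2 + C * D\<^sup>2)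
      = 4 * (x * y * w * (r\<^sup>2 * (x + y + w) - x * y * w))"
    unfolding A_def B_def C_def D_def E_def F_def
    by (simp add: algebra_simps power2_eq_square)
  ultimately have "x * y * w * (r\<^sup>2 * (x + y + w) - x * y * w) = 0"
    by linarith
  moreover have "0 < x" "0 < y" "0 < w"
    unfolding x_def y_def w_def
    using tangent_length_pos[of P Q R z r] tangent_length_pos[of Q R P z r]
      tangent_length_pos[of R P Q z r] assms by (simp_all add: insert_commute)
  ultimately show ?thesis
    by simp
qed

text \<open>The first part holds because the incenter lies on the bisector of the angle at \<open>P\<close>, so that
  it spans with \<open>P\<close> and a point of contact a right triangle with legs \<open>r\<close> and \<open>x\<close>. For the second,
  the angle at the incenter between \<open>Q\<close> and \<open>R\<close> is \<open>pi\<close> minus half the angles at \<open>Q\<close> and \<open>R\<close>, which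
  is \<open>pi / 2\<close> plus half the angle at \<open>P\<close>. In terms of tangent lengths, both become consequences of
  the product relation.\<close>

lemma half_angle_and_opposite_directions:
  fixes P Q R z :: "real^2"
  assumes nc: "\<not> collinear {P, Q, R}"
    and tan: "side_tangent_to_circle P Q z r" "side_tangent_to_circle Q R z r"
      "side_tangent_to_circle R P z r"
    and r: "0 < r"
  shows sin_half_angle_incenter: "sin (internal_angle R P Q / 2) = r / dist P z"
    and inner_directions_incenter: "sgn (Q - z) \<bullet> sgn (R - z) = - (r / dist P z)"
proof -
  define x y w where "x = tangent_length z r P" and "y = tangent_length z r Q"
    and "w = tangent_length z r R"
  note m = tangent_side_metric[OF tan(1), folded x_def y_def]
    tangent_side_metric[OF tan(2), folded y_def w_def]
    tangent_side_metric[OF tan(3), folded w_def x_def]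
  have pos: "0 < x" "0 < y" "0 < w"
    unfolding x_def y_def w_def
    using tangent_length_pos[of P Q R z r] tangent_length_pos[of Q R P z r]
      tangent_length_pos[of R P Q z r] assms by (simp_all add: insert_commute)
  have prod: "x * y * w = r\<^sup>2 * (x + y + w)"
    unfolding x_def y_def w_def using tangent_lengths_product[OF nc tan] .
  define d e f where "d = dist P z" and "e = dist Q z" and "f = dist R z"
  have d2: "d\<^sup>2 = r\<^sup>2 + x\<^sup>2" and e2: "e\<^sup>2 = r\<^sup>2 + y\<^sup>2" and f2: "f\<^sup>2 = r\<^sup>2 + w\<^sup>2"
    unfolding d_def e_def f_def dist_norm power2_norm_eq_inner using m by simp_all
  have "d \<noteq> 0" "e \<noteq> 0" "f \<noteq> 0"
    using d2 e2 f2 r by (auto simp: sum_power2_eq_zero_iff)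
  then have dpos: "0 < d" "0 < e" "0 < f"
    by (simp_all add: d_def e_def f_def)

  \<comment> \<open>The cosine of the angle at \<open>P\<close> is rational in the tangent lengths, and the product relation
    turns it into \<open>1 - 2 * (r / d)\<^sup>2\<close>, the double-angle formula for the sine \<open>r / d\<close>.\<close>
  have "(R - P) \<bullet> (Q - P) = ((R - z) - (P - z)) \<bullet> ((Q - z) - (P - z))"
    by simp
  also have "\<dots> = x * (x + y + w) - y * w"
    unfolding inner_diff_left[of "R - z"] inner_diff_right[of _ "Q - z"]
    using m by (simp add: inner_commute algebra_simps power2_eq_square)
  finally have num: "(R - P) \<bullet> (Q - P) = x * (x + y + w) - y * w" .
  have "(x * (x + y + w) - y * w) / ((w + x) * (x + y)) = 1 - 2 * (r / d)\<^sup>2"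
  proof -
    have "(x * (x + y + w) - y * w) * d\<^sup>2 = (d\<^sup>2 - 2 * r\<^sup>2) * ((w + x) * (x + y))"
      using arg_cong[OF prod, of "(*) x"] unfolding d2
      by (simp add: algebra_simps power2_eq_square)
    moreover have "0 < (w + x) * (x + y)"
      using pos by simp
    ultimately have "(x * (x + y + w) - y * w) / ((w + x) * (x + y)) = (d\<^sup>2 - 2 * r\<^sup>2) / d\<^sup>2"
      using dpos by (subst frac_eq_eq) auto
    then show ?thesis
      using dpos by (simp add: diff_divide_distrib power_divide)
  qed
  then have angle: "internal_angle R P Q = arccos (1 - 2 * (r / d)\<^sup>2)"
    using m(6) m(18) num by (simp add: internal_angle_def dist_norm norm_minus_commute)
  have "r \<le> d"
    using d2 dpos r by (auto intro: power2_le_imp_le)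
  then have "0 \<le> r / d" "r / d \<le> 1"
    using r dpos by auto
  have "(r / d)\<^sup>2 \<le> 1"
    using \<open>0 \<le> r / d\<close> \<open>r / d \<le> 1\<close> power_le_one by blast
  then have rng: "-1 \<le> 1 - 2 * (r / d)\<^sup>2" "1 - 2 * (r / d)\<^sup>2 \<le> 1"
    by auto
  define th where "th = internal_angle R P Q"
  have "cos th = 1 - 2 * (r / d)\<^sup>2"
    unfolding th_def angle using rng by (rule cos_arccos)
  moreover have "cos th = 1 - 2 * (sin (th / 2))\<^sup>2"
    using cos_double_sin[of "th / 2"] by simp
  ultimately have "(sin (th / 2))\<^sup>2 = (r / d)\<^sup>2"
    by linarith
  moreover have "0 \<le> th" "th \<le> pi"
    unfolding th_def angle using rng by (simp_all add: arccos_lbound arccos_ubound)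
  then have "0 \<le> sin (th / 2)"
    by (intro sin_ge_zero) auto
  ultimately show "sin (internal_angle R P Q / 2) = r / dist P z"
    using \<open>0 \<le> r / d\<close> by (metis d_def th_def power2_eq_iff_nonneg)

  \<comment> \<open>The product relation makes \<open>y * w - r\<^sup>2\<close> positive, which selects the sign when the square
    root of the identity \<open>sq\<close> is taken.\<close>
  have opp: "x * (y * w - r\<^sup>2) = r\<^sup>2 * (y + w)"
    using prod by (simp add: algebra_simps)
  have sq: "((y * w - r\<^sup>2) * d)\<^sup>2 = (r * e * f)\<^sup>2"
    using arg_cong[OF opp, of "\<lambda>t. t\<^sup>2"] unfolding power_mult_distrib d2 e2 f2
    by (simp add: algebra_simps power2_eq_square)
  from opp have "0 < x * (y * w - r\<^sup>2)"
    using pos r by simp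
  then have "0 < y * w - r\<^sup>2"
    using pos by (simp add: zero_less_mult_iff)
  then have "(y * w - r\<^sup>2) * d = r * e * f"
    using sq dpos r by (simp add: power2_eq_iff_nonneg)
  then have "(r\<^sup>2 - y * w) / (e * f) = - (r / d)"
    using dpos by (simp add: field_simps)
  then show "sgn (Q - z) \<bullet> sgn (R - z) = - (r / dist P z)"
    using m(11) by (simp add: sgn_div_norm d_def e_def f_def dist_norm divide_inverse mult_ac)
qed

section \<open>Orthocenter of three unit vectors\<close>

text \<open>A line orthogonal to a nonzero \<open>t\<close> meets the unit circle at most twice. Quantitatively: the area of an
  inscribed triangle is the product of its sides divided by four times the circumradius, so the
  determinant \<open>D\<close> of two of its sides does not vanish.\<close>

lemma inner_equal_distinct_unit_imp_zero:
  fixes t u v w :: "real^2"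
  assumes unit: "u \<bullet> u = 1" "v \<bullet> v = 1" "w \<bullet> w = 1"
    and dist: "u \<noteq> v" "v \<noteq> w" "w \<noteq> u"
    and eq: "t \<bullet> u = t \<bullet> v" "t \<bullet> v = t \<bullet> w"
  shows "t = 0"
proof -
  define p q where "p = v - u" and "q = w - u"
  define D where "D = p$1 * q$2 - p$2 * q$1"
  have chord: "u \<bullet> p = - (p \<bullet> p) / 2" "q \<bullet> u = - (q \<bullet> q) / 2"
    using unit
    by (simp_all add: p_def q_def inner_diff_left inner_diff_right inner_commute field_simps)
  have "D\<^sup>2 = (p \<bullet> p) * (q \<bullet> q) - (p \<bullet> q)\<^sup>2"
    by (simp add: D_def inner_vec_def sum_2 algebra_simps power2_eq_square)
  also have "\<dots> = (p \<bullet> p) * (q \<bullet> q) * ((p \<bullet> p) + (q \<bullet> q) - 2 * (p \<bullet> q)) / 4"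
    using gram_det_3_real2[of u p q] unit(1)
    unfolding chord by (simp add: field_simps power2_eq_square)
  also have "(p \<bullet> p) + (q \<bullet> q) - 2 * (p \<bullet> q) = (p - q) \<bullet> (p - q)"
    by (simp add: inner_diff_left inner_diff_right inner_commute)
  finally have "D \<noteq> 0"
    using dist by (auto simp: p_def q_def)
  have "t \<bullet> p = 0" "t \<bullet> q = 0"
    using eq by (simp_all add: p_def q_def inner_diff_right)
  moreover have "D * t$1 = q$2 * (t \<bullet> p) - p$2 * (t \<bullet> q)"
    "D * t$2 = p$1 * (t \<bullet> q) - q$1 * (t \<bullet> p)"
    by (simp_all add: D_def inner_vec_def sum_2 algebra_simps)
  ultimately have "D * t$1 = 0" "D * t$2 = 0"
    by simp_all
  with \<open>D \<noteq> 0\<close> show ?thesis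
    by (simp add: vec_eq_iff forall_2)
qed

text \<open>The sum \<open>u + v + w\<close> satisfies the altitude equations too, as \<open>(u + v) \<bullet> (u - v) = 0\<close> for
  unit vectors. Hence its difference to \<open>h\<close> is orthogonal to all sides.\<close>

lemma orthocenter_eq_sum:
  fixes h u v w :: "real^2"
  assumes unit: "u \<bullet> u = 1" "v \<bullet> v = 1" "w \<bullet> w = 1"
    and dist: "u \<noteq> v" "v \<noteq> w" "w \<noteq> u"
    and alt: "(w - h) \<bullet> (u - v) = 0" "(u - h) \<bullet> (v - w) = 0"
  shows "h = u + v + w"
proof -
  have "u + v + w - h = 0"
    using unit dist
  proof (rule inner_equal_distinct_unit_imp_zero)
    show "(u + v + w - h) \<bullet> u = (u + v + w - h) \<bullet> v"
      "(u + v + w - h) \<bullet> v = (u + v + w - h) \<bullet> w"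
      using unit alt
      by (simp_all add: inner_add_left inner_diff_left inner_diff_right inner_commute[of v u]
          inner_commute[of w u] inner_commute[of w v])
  qed
  then show ?thesis
    by simp
qed

section \<open>The focal family\<close>

text \<open>This is the polar equation about the focus, multiplied out: dividing by \<open>dist P z\<close> gives
  \<open>b\<^sup>2 / dist P z = a + c * cos \<phi>\<close>, with \<open>\<phi>\<close> the direction of \<open>P\<close> seen from the focus.\<close>

lemma ellipse_focal_polar:
  fixes a b c :: real and P :: "real^2"
  assumes "0 < b" "b < a" and c: "c\<^sup>2 = a\<^sup>2 - b\<^sup>2" "0 < c"
    and "P \<in> ellipse a b"
  defines "z \<equiv> vector [c, 0] :: real^2"
  shows "a * dist P z + c * (P - z) $ 1 = b\<^sup>2"
proof -
  have a: "0 < a"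
    using assms by simp
  have ell: "b\<^sup>2 * (P$1)\<^sup>2 + a\<^sup>2 * (P$2)\<^sup>2 = a\<^sup>2 * b\<^sup>2"
    using assms a by (simp add: ellipse_def field_simps)
  have "(dist P z)\<^sup>2 = (P$1 - c)\<^sup>2 + (P$2)\<^sup>2"
    unfolding dist_norm power2_norm_eq_inner
    by (simp add: z_def inner_vec_def sum_2 power2_eq_square)
  then have "(a * dist P z)\<^sup>2 = a\<^sup>2 * ((P$1 - c)\<^sup>2 + (P$2)\<^sup>2)"
    by (simp add: power_mult_distrib)
  also have "\<dots> = (a\<^sup>2 - c * P$1)\<^sup>2"
  proof -
    have b2: "b\<^sup>2 = a\<^sup>2 - c\<^sup>2"
      using c(1) by simp
    show ?thesis
      using ell unfolding b2 by (simp add: algebra_simps power2_eq_square)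
  qed
  finally have sq: "(a * dist P z)\<^sup>2 = (a\<^sup>2 - c * P$1)\<^sup>2" .
  \<comment> \<open>Taking the root needs \<open>c * P$1 \<le> a\<^sup>2\<close>: the vertex lies on the near side of the directrix.\<close>
  have "(P$1)\<^sup>2 \<le> a\<^sup>2"
  proof -
    have "b\<^sup>2 * (P$1)\<^sup>2 \<le> b\<^sup>2 * a\<^sup>2"
      using ell zero_le_power2[of "a * P$2"] unfolding power_mult_distrib mult.commute[of "b\<^sup>2" "a\<^sup>2"]
      by linarith
    then show ?thesis
      using assms(1) by simp
  qed
  then have "P$1 \<le> a"
    using a by (metis abs_le_square_iff abs_of_pos abs_le_D1)
  moreover have "c \<le> a"
    using c a by (auto intro: power2_le_imp_le)
  ultimately have "c * P$1 \<le> a\<^sup>2"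
    using c(2) a by (smt (verit) mult_left_mono mult_right_mono power2_eq_square)
  then have "a * dist P z = a\<^sup>2 - c * P$1"
    using sq a by (simp add: power2_eq_iff_nonneg)
  then show ?thesis
    using c(1) by (simp add: z_def power2_eq_square algebra_simps)
qed

text \<open>The radius is left arbitrary here: the sum is the same for all triangles with a given incircle
  about the focus. Summing the affine expressions for the half-angle sines as well gives a quadratic
  equation for \<open>r\<close>, whose positive root is the only radius for which such triangles exist.\<close>

lemma sum_sin_half_angles_focal:
  fixes a b c r :: real and P Q R :: "real^2"
  assumes "0 < b" "b < a" "c\<^sup>2 = a\<^sup>2 - b\<^sup>2" "0 < c" "0 < r"
    and fam: "(P, Q, R) \<in> poncelet_family (ellipse a b) (vector [c, 0]) r"
  shows "sin (internal_angle R P Q / 2) + sin (internal_angle P Q R / 2)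
             + sin (internal_angle Q R P / 2) = (3 - (r * c / b\<^sup>2)\<^sup>2) / 2"
proof -
  define z :: "real^2" where "z = vector [c, 0]"
  have nc: "\<not> collinear {P, Q, R}" "\<not> collinear {Q, R, P}" "\<not> collinear {R, P, Q}"
    and ell: "P \<in> ellipse a b" "Q \<in> ellipse a b" "R \<in> ellipse a b"
    and tan: "side_tangent_to_circle P Q z r" "side_tangent_to_circle Q R z r"
      "side_tangent_to_circle R P z r"
    using fam by (auto simp: poncelet_family_def z_def insert_commute)
  note s = sin_half_angle_incenter[OF nc(1) tan \<open>0 < r\<close>]
    sin_half_angle_incenter[OF nc(2) tan(2,3,1) \<open>0 < r\<close>]
    sin_half_angle_incenter[OF nc(3) tan(3,1,2) \<open>0 < r\<close>]
  define u v w where "u = sgn (P - z)" and "v = sgn (Q - z)" and "w = sgn (R - z)"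
  have inner: "v \<bullet> w = - (r / dist P z)" "w \<bullet> u = - (r / dist Q z)" "u \<bullet> v = - (r / dist R z)"
    unfolding u_def v_def w_def
    using inner_directions_incenter[OF nc(1) tan \<open>0 < r\<close>]
      inner_directions_incenter[OF nc(2) tan(2,3,1) \<open>0 < r\<close>]
      inner_directions_incenter[OF nc(3) tan(3,1,2) \<open>0 < r\<close>] by simp_all
  \<comment> \<open>The focus is inside the ellipse, so the directions to the vertices are defined.\<close>
  have off: "X \<noteq> z" if "X \<in> ellipse a b" for X
  proof
    assume "X = z"
    with ellipse_focal_polar[OF assms(1-4) that] \<open>0 < b\<close> show False
      by (simp add: z_def)
  qed
  define h :: "real^2" where "h = vector [r * c / b\<^sup>2, 0]"
  have polar: "r / dist X z = r * a / b\<^sup>2 + h \<bullet> sgn (X - z)" if "X \<in> ellipse a b" for X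
  proof -
    define d \<xi> where "d = dist X z" and "\<xi> = (X - z) $ 1"
    have "0 < d"
      using off[OF that] by (simp add: d_def)
    have "r / d = r * (a * d + c * \<xi>) / (b\<^sup>2 * d)"
      using ellipse_focal_polar[OF assms(1-4) that] \<open>0 < b\<close>
      by (simp add: z_def d_def \<xi>_def)
    also have "\<dots> = r * a / b\<^sup>2 + r * c / b\<^sup>2 * \<xi> / d"
      using \<open>0 < b\<close> \<open>0 < d\<close> by (simp add: field_simps)
    also have "r * c / b\<^sup>2 * \<xi> / d = h \<bullet> sgn (X - z)"
      by (simp add: h_def inner_vec_def sum_2 sgn_div_norm dist_norm divide_inverse d_def \<xi>_def)
    finally show ?thesis
      by (simp add: d_def)
  qed
  have unit: "u \<bullet> u = 1" "v \<bullet> v = 1" "w \<bullet> w = 1"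
    using off ell by (simp_all add: u_def v_def w_def dot_square_norm norm_sgn)
  \<comment> \<open>Any two of the directions form an obtuse angle, hence they are distinct.\<close>
  have "0 < r / dist P z" "0 < r / dist Q z" "0 < r / dist R z"
    using off ell \<open>0 < r\<close> by simp_all
  then have dist: "u \<noteq> v" "v \<noteq> w" "w \<noteq> u"
    using inner unit by auto
  have "h = u + v + w"
  proof (rule orthocenter_eq_sum[OF unit dist])
    show "(w - h) \<bullet> (u - v) = 0" "(u - h) \<bullet> (v - w) = 0"
      using inner polar[OF ell(1)] polar[OF ell(2)] polar[OF ell(3)]
      by (simp_all add: inner_diff_left inner_diff_right inner_commute flip: u_def v_def w_def)
  qed
  then have "h \<bullet> h = 3 + 2 * (u \<bullet> v + v \<bullet> w + w \<bullet> u)"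
    using unit by (simp add: inner_add_left inner_add_right inner_commute)
  moreover have "h \<bullet> h = (r * c / b\<^sup>2)\<^sup>2"
    by (simp add: h_def inner_vec_def sum_2 power2_eq_square)
  ultimately show ?thesis
    using inner s by (simp add: field_simps)
qed

theorem proposition2:
  fixes a b c r\<^sub>1 :: real
  assumes "0 < b" and "b < a"
    and "c = sqrt (a\<^sup>2 - b\<^sup>2)"
    and "r\<^sub>1 = b\<^sup>2 / c\<^sup>2 * (sqrt (a\<^sup>2 + c\<^sup>2) - a)"
  shows "\<forall>(P, Q, R) \<in> poncelet_family (ellipse a b) (vector [c, 0]) r\<^sub>1.
           sin (internal_angle R P Q / 2) + sin (internal_angle P Q R / 2)
             + sin (internal_angle Q R P / 2)
           = (c\<^sup>2 - a\<^sup>2 + a * sqrt (a\<^sup>2 + c\<^sup>2)) / c\<^sup>2"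
proof -
  have "b\<^sup>2 < a\<^sup>2"
    using assms(1,2) by (simp add: power_strict_mono)
  then have c: "0 < c" "c\<^sup>2 = a\<^sup>2 - b\<^sup>2"
    by (simp_all add: assms(3))
  define q where "q = sqrt (a\<^sup>2 + c\<^sup>2)"
  have q2: "q\<^sup>2 = a\<^sup>2 + c\<^sup>2"
    by (simp add: q_def)
  have "a < q"
    unfolding q_def using c(1) by (intro real_less_rsqrt) simp
  then have r: "0 < r\<^sub>1"
    using assms(1) c(1) by (simp add: assms(4) q_def)
  have "r\<^sub>1 * c / b\<^sup>2 = (q - a) / c"
    using assms(1) c(1) by (simp add: assms(4) q_def power2_eq_square)
  then have "(3 - (r\<^sub>1 * c / b\<^sup>2)\<^sup>2) / 2 = (3 - (q - a)\<^sup>2 / c\<^sup>2) / 2"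
    by (simp add: power_divide)
  also have "\<dots> = (3 * c\<^sup>2 - (q - a)\<^sup>2) / (2 * c\<^sup>2)"
    using c(1) by (simp add: field_simps)
  also have "\<dots> = (c\<^sup>2 - a\<^sup>2 + a * q) / c\<^sup>2"
  proof -
    have "3 * c\<^sup>2 - (q - a)\<^sup>2 = 2 * (c\<^sup>2 - a\<^sup>2 + a * q)"
      using q2 by (simp add: power2_diff algebra_simps)
    then show ?thesis
      by (simp only: mult_divide_mult_cancel_left)
  qed
  finally have total: "(3 - (r\<^sub>1 * c / b\<^sup>2)\<^sup>2) / 2 = (c\<^sup>2 - a\<^sup>2 + a * sqrt (a\<^sup>2 + c\<^sup>2)) / c\<^sup>2"
    by (simp only: q_def)
  show ?thesis
    using sum_sin_half_angles_focal[OF assms(1,2) c(2,1) r, unfolded total] by blast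
qed

end
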